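(* Let $p,q>1$, $A>0$, $B>0$, $R\ge 1$, and let $f\in C_0^2(\mathbf{R})$ be a real-valued function with $\operatorname{supp} f\subset\{x\in\mathbf{R}:|x|\le R\}$. Assume that $$f(x)\ge 0\ (f\not\equiv 0),\qquad f'(x)<0\ \text{ for } x\in(0,R),\qquad\text{and}\qquad g(x)\equiv 0,$$ where $f(x)\ge0$ is required for all $x\in\mathbf{R}$. Then there exist a positive constant $\varepsilon_4=\varepsilon_4(f,p,q,A,B,R)>0$ and a positive constant $C$ independent of $\varepsilon$ such that, for every $\varepsilon$ with $0<\varepsilon\le\varepsilon_4$, a classical solution on $\mathbf{R}\times[0,T]$ of the initial value problem $$u_{tt}-u_{xx}=A|u_t|^p+B|u|^q,\qquad u(x,0)=\varepsilon f(x),\quad u_t(x,0)=\varepsilon g(x)=0\quad(x\in\mathbf{R})$$ cannot exist whenever $T$ satisfies $$T\ge\begin{cases} C\,\varepsilon^{-(p-1)} & \text{for } p\le \dfrac{q+1}{2},\\[2mm] C\,\varepsilon^{-p(q-1)/(q+1)} & \text{for } \dfrac{q+1}{2}\le p\le q,\\[2mm] C\,\varepsilon^{-q(q-1)/(q+1)} & \text{for } p\ge q.\end{cases}$$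
   Context: Here $C_0^k(\mathbf{R})$ denotes the space of $k$ times continuously differentiable functions on $\mathbf{R}$ with compact support. A classical solution on $\mathbf{R}\times[0,T]$ is a real-valued function $u=u(x,t)$ of class $C^2$ on $\mathbf{R}\times[0,T]$ satisfying the equation there and the initial conditions at $t=0$. *)

theory Defs
  imports "HOL-Analysis.Analysis"
begin

text \<open>
  Class \<open>C\<^sup>k\<close> on a set. The derivative is taken within the set, so at boundary points of a strip
  \<open>UNIV \<times> {0..T}\<close> with \<open>T > 0\<close> it is one-sided; it is unique there, and likewise on \<open>UNIV\<close>, hence
  the witness \<open>D\<close> is determined on the sets considered.
\<close>

primrec Ck_on :: "nat \<Rightarrow> 'a::euclidean_space set \<Rightarrow> ('a \<Rightarrow> real) \<Rightarrow> bool" where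
  "Ck_on 0 S f \<longleftrightarrow> continuous_on S f"
| "Ck_on (Suc k) S f \<longleftrightarrow>
     (\<exists>D. (\<forall>z\<in>S. (f has_derivative D z) (at z within S)) \<and>
          (\<forall>b\<in>Basis. Ck_on k S (\<lambda>z. D z b)))"

definition supp :: "(real \<Rightarrow> real) \<Rightarrow> real set" where
  "supp f = closure {x. f x \<noteq> 0}"

definition C0k :: "nat \<Rightarrow> (real \<Rightarrow> real) set" where
  "C0k k = {f. Ck_on k UNIV f \<and> compact (supp f)}"

definition partial_x :: "(real \<Rightarrow> real \<Rightarrow> real) \<Rightarrow> real \<Rightarrow> real \<Rightarrow> real" where
  "partial_x u x t = deriv (\<lambda>y. u y t) x"

text \<open>One-sided at \<open>t = 0\<close> and \<open>t = T\<close>.\<close>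

definition partial_t :: "real \<Rightarrow> (real \<Rightarrow> real \<Rightarrow> real) \<Rightarrow> real \<Rightarrow> real \<Rightarrow> real" where
  "partial_t T u x t = vector_derivative (\<lambda>s. u x s) (at t within {0..T})"

definition classical_solution ::
  "real \<Rightarrow> real \<Rightarrow> real \<Rightarrow> real \<Rightarrow> real \<Rightarrow> (real \<Rightarrow> real) \<Rightarrow> (real \<Rightarrow> real) \<Rightarrow> real
    \<Rightarrow> (real \<Rightarrow> real \<Rightarrow> real) \<Rightarrow> bool" where
  "classical_solution p q A B \<epsilon> f g T u \<longleftrightarrow>
     Ck_on 2 (UNIV \<times> {0..T}) (\<lambda>(x, t). u x t) \<and>
     (\<forall>x. \<forall>t\<in>{0..T}.
        partial_t T (partial_t T u) x t - partial_x (partial_x u) x t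
          = A * \<bar>partial_t T u x t\<bar> powr p + B * \<bar>u x t\<bar> powr q) \<and>
     (\<forall>x. u x 0 = \<epsilon> * f x \<and> partial_t T u x 0 = \<epsilon> * g x)"

end

theory Submission
  imports Defs
begin

text \<open>
  The Riemann invariants \<open>z = u\<^sub>t - u\<^sub>x\<close> and \<open>w = u\<^sub>t + u\<^sub>x\<close> have derivative
  \<open>F = A \<bar>u\<^sub>t\<bar>\<^sup>p + B \<bar>u\<bar>\<^sup>q \<ge> 0\<close> along the lines \<open>x - t = const\<close> and \<open>x + t = const\<close> respectively.
  For \<open>x + t > R\<close> and \<open>x - t \<in> (0, R)\<close> the data of \<open>w\<close> vanish, so \<open>w \<ge> 0\<close> and \<open>z \<ge> - \<epsilon> f'(x - t) > 0\<close>,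
  whence \<open>u\<^sub>t \<ge> z / 2\<close>. On one such ray \<open>z' \<ge> A (z / 2)\<^sup>p\<close> with \<open>z\<close> initially of size \<open>\<epsilon>\<close>, which
  forces blow-up at time of order \<open>\<epsilon> powr (- (p - 1))\<close>. On a whole strip of such rays
  \<open>F\<close> is bounded below by a multiple of \<open>\<epsilon>\<^sup>r\<close>, with \<open>r = p\<close> because of \<open>u\<^sub>t\<close> and \<open>r = q\<close> because of
  \<open>u\<close>; hence \<open>u\<close> is at least of size \<open>\<epsilon>\<^sup>r (x + t)\<close> behind the strip. Iterating
  \<open>u\<^sub>t\<^sub>t - u\<^sub>x\<^sub>x \<ge> B u\<^sup>q\<close> on a dyadically shrinking family of characteristic squares of side comparable
  to \<open>T\<close> gives blow-up once \<open>T\<^sup>2 \<cdot> (\<epsilon>\<^sup>r T) powr (q - 1)\<close> is large, i.e. at time of order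
  \<open>\<epsilon> powr (- r (q - 1) / (q + 1))\<close>.
\<close>

subsection \<open>Characteristic derivatives on a strip\<close>

text \<open>The mean value theorem is applied twice: in x to the difference of the slices at
  \<open>b + h\<close> and \<open>b\<close>, then in t to \<open>ux\<close> at the intermediate
  x.\<close>

lemma double_difference_MVT:
  fixes u ux uxt :: "real \<Rightarrow> real \<Rightarrow> real"
  assumes "h > 0"
    and "\<And>x t. x \<in> {a..a+h} \<Longrightarrow> t \<in> {b..b+h} \<Longrightarrow> ((\<lambda>y. u y t) has_real_derivative ux x t) (at x)"
    and "\<And>x t. x \<in> {a..a+h} \<Longrightarrow> t \<in> {b..b+h} \<Longrightarrow> ((\<lambda>s. ux x s) has_real_derivative uxt x t) (at t)"
  shows "\<exists>x\<in>{a<..<a+h}. \<exists>t\<in>{b<..<b+h}.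
           u (a+h) (b+h) - u (a+h) b - u a (b+h) + u a b = h * h * uxt x t"
proof -
  have "\<exists>x>a. x < a + h \<and>
      (u (a+h) (b+h) - u (a+h) b) - (u a (b+h) - u a b) = (a + h - a) * (ux x (b+h) - ux x b)"
    by (rule MVT2) (use assms in \<open>auto intro!: DERIV_diff\<close>)
  then obtain x where x: "a < x" "x < a + h"
    "(u (a+h) (b+h) - u (a+h) b) - (u a (b+h) - u a b) = h * (ux x (b+h) - ux x b)"
    by auto
  have "\<exists>t>b. t < b + h \<and> ux x (b+h) - ux x b = (b + h - b) * uxt x t"
    by (rule MVT2) (use assms x in auto)
  then obtain t where t: "b < t" "t < b + h" "ux x (b+h) - ux x b = h * uxt x t"
    by auto
  show ?thesis
    by (rule bexI[of _ x], rule bexI[of _ t]) (use x t in auto)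
qed

text \<open>The double difference over a square is symmetric in x and t, so it is
  \<open>h * h\<close> times \<open>uxt\<close> at one point and \<open>h * h\<close> times
  \<open>utx\<close> at another. Both points tend to \<open>(a, b)\<close> with \<open>h\<close>,
  and continuity there identifies the two values.\<close>

lemma mixed_partials_eq:
  fixes u ux ut uxt utx :: "real \<Rightarrow> real \<Rightarrow> real"
  assumes "r > 0"
    and ux: "\<And>x t. \<bar>x - a\<bar> < r \<Longrightarrow> \<bar>t - b\<bar> < r \<Longrightarrow> ((\<lambda>y. u y t) has_real_derivative ux x t) (at x)"
    and ut: "\<And>x t. \<bar>x - a\<bar> < r \<Longrightarrow> \<bar>t - b\<bar> < r \<Longrightarrow> ((\<lambda>s. u x s) has_real_derivative ut x t) (at t)"
    and uxt: "\<And>x t. \<bar>x - a\<bar> < r \<Longrightarrow> \<bar>t - b\<bar> < r \<Longrightarrow> ((\<lambda>s. ux x s) has_real_derivative uxt x t) (at t)"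
    and utx: "\<And>x t. \<bar>x - a\<bar> < r \<Longrightarrow> \<bar>t - b\<bar> < r \<Longrightarrow> ((\<lambda>y. ut y t) has_real_derivative utx x t) (at x)"
    and cxt: "isCont (\<lambda>z. uxt (fst z) (snd z)) (a, b)"
    and ctx: "isCont (\<lambda>z. utx (fst z) (snd z)) (a, b)"
  shows "uxt a b = utx a b"
proof -
  have "\<bar>uxt a b - utx a b\<bar> \<le> e" if e: "e > 0" for e
  proof -
    obtain d1 where d1: "d1 > 0" "\<And>z. dist z (a, b) < d1 \<Longrightarrow> dist (uxt (fst z) (snd z)) (uxt a b) < e / 2"
      using cxt[unfolded continuous_at_eps_delta] half_gt_zero[OF e] by fastforce
    obtain d2 where d2: "d2 > 0" "\<And>z. dist z (a, b) < d2 \<Longrightarrow> dist (utx (fst z) (snd z)) (utx a b) < e / 2"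
      using ctx[unfolded continuous_at_eps_delta] half_gt_zero[OF e] by fastforce
    \<comment> \<open>\<open>h < r\<close> keeps the square where the derivatives exist;
      \<open>2 * h\<close> bounds the distance of its inner points from the corner
      \<open>(a, b)\<close>.\<close>
    define h where "h = min (r / 2) (min (d1 / 2) (d2 / 2))"
    have h: "h > 0" "h < r" "2 * h \<le> d1" "2 * h \<le> d2"
      using \<open>r > 0\<close> d1(1) d2(1) by (auto simp: h_def)
    have close: "dist (x, t) (a, b) < 2 * h" if "x \<in> {a<..<a+h}" "t \<in> {b<..<b+h}" for x t
    proof -
      have "dist (x, t) (a, b) \<le> \<bar>x - a\<bar> + \<bar>t - b\<bar>"
        unfolding dist_prod_def by (simp add: dist_real_def sqrt_sum_squares_le_sum_abs)
      then show ?thesis using that by auto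
    qed
    obtain x t where xt: "x \<in> {a<..<a+h}" "t \<in> {b<..<b+h}"
      "u (a+h) (b+h) - u (a+h) b - u a (b+h) + u a b = h * h * uxt x t"
      using double_difference_MVT[of h a b u ux uxt] h(1,2) ux uxt by fastforce
    \<comment> \<open>The same lemma with the roles of x and t exchanged.\<close>
    obtain t' x' where tx: "x' \<in> {a<..<a+h}" "t' \<in> {b<..<b+h}"
      "u (a+h) (b+h) - u a (b+h) - u (a+h) b + u a b = h * h * utx x' t'"
      using double_difference_MVT[of h b a "\<lambda>t x. u x t" "\<lambda>t x. ut x t" "\<lambda>t x. utx x t"] h(1,2) ut utx
      by fastforce
    have "h * h * uxt x t = h * h * utx x' t'"
      using xt(3) tx(3) by linarith
    then have eq: "uxt x t = utx x' t'" using h(1) by simp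
    have "\<bar>uxt x t - uxt a b\<bar> < e / 2"
      using d1(2)[of "(x, t)"] close[OF xt(1,2)] h by (simp add: dist_real_def)
    moreover have "\<bar>utx x' t' - utx a b\<bar> < e / 2"
      using d2(2)[of "(x', t')"] close[OF tx(1,2)] h by (simp add: dist_real_def)
    ultimately show ?thesis using eq by linarith
  qed
  then have "\<bar>uxt a b - utx a b\<bar> \<le> 0"
    by (meson dense_ge)
  then show ?thesis by simp
qed

section \<open>Partial derivatives on the closed strip\<close>

lemma Ck_on_Suc_obtain_partials:
  fixes F :: "real \<times> real \<Rightarrow> real"
  assumes "Ck_on (Suc k) S F"
  obtains Fx Ft where "Ck_on k S Fx" "Ck_on k S Ft"
    "\<And>z. z \<in> S \<Longrightarrow> (F has_derivative (\<lambda>h. fst h * Fx z + snd h * Ft z)) (at z within S)"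
proof -
  obtain D where D: "\<And>z. z \<in> S \<Longrightarrow> (F has_derivative D z) (at z within S)"
    and C: "\<And>b. b \<in> Basis \<Longrightarrow> Ck_on k S (\<lambda>z. D z b)"
    using assms by auto
  have "D z = (\<lambda>h. fst h * D z (1, 0) + snd h * D z (0, 1))" if "z \<in> S" for z
  proof
    fix h :: "real \<times> real"
    interpret bounded_linear "D z"
      using D[OF that] by (rule has_derivative_bounded_linear)
    have "h = fst h *\<^sub>R (1, 0) + snd h *\<^sub>R (0, 1)"
      by (simp add: prod_eq_iff)
    then have "D z h = D z (fst h *\<^sub>R (1, 0) + snd h *\<^sub>R (0, 1))" by simp
    then show "D z h = fst h * D z (1, 0) + snd h * D z (0, 1)"
      by (simp only: add scaleR real_scaleR_def)
  qed
  then show thesis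
    using that[of "\<lambda>z. D z (1, 0)" "\<lambda>z. D z (0, 1)"] D C by (auto simp: Basis_prod_def)
qed

text \<open>Chain rule for a line of slope \<open>a\<close> in x: \<open>a = 0\<close> gives the
  time derivative, \<open>a = 1\<close> and \<open>a = -1\<close> the two characteristic directions.
  Derivatives stay one-sided at t = 0 and t = T.\<close>

lemma strip_derivative_along_line:
  fixes F :: "real \<times> real \<Rightarrow> real"
  assumes "\<And>z. z \<in> UNIV \<times> {0..T} \<Longrightarrow>
      (F has_derivative (\<lambda>h. fst h * Fx z + snd h * Ft z)) (at z within UNIV \<times> {0..T})"
    and "t \<in> {0..T}"
  shows "((\<lambda>s. F (c + a * s, s)) has_real_derivative a * Fx (c + a * t, t) + Ft (c + a * t, t))
           (at t within {0..T})"
proof -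
  have "((\<lambda>s. (c + a * s, s)) has_derivative (\<lambda>k. (a * k, k))) (at t within {0..T})"
    by (auto intro!: derivative_eq_intros)
  from has_derivative_in_compose2[OF assms(1) _ assms(2) this]
  have "((\<lambda>s. F (c + a * s, s)) has_derivative
      (\<lambda>k. fst (a * k, k) * Fx (c + a * t, t) + snd (a * k, k) * Ft (c + a * t, t))) (at t within {0..T})"
    by fastforce
  then show ?thesis
    unfolding has_field_derivative_def
    by (rule has_derivative_eq_rhs) (auto simp: algebra_simps)
qed

lemma strip_derivative_horizontal:
  fixes F :: "real \<times> real \<Rightarrow> real"
  assumes "\<And>z. z \<in> UNIV \<times> {0..T} \<Longrightarrow>
      (F has_derivative (\<lambda>h. fst h * Fx z + snd h * Ft z)) (at z within UNIV \<times> {0..T})"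
    and "t \<in> {0..T}"
  shows "((\<lambda>y. F (y, t)) has_real_derivative Fx (x, t)) (at x)"
proof -
  have "((\<lambda>y. (y, t)) has_derivative (\<lambda>k. (k, 0))) (at x within UNIV)"
    by (auto intro!: derivative_eq_intros)
  from has_derivative_in_compose2[OF assms(1) _ _ this]
  have "((\<lambda>y. F (y, t)) has_derivative
      (\<lambda>k. fst (k, 0::real) * Fx (x, t) + snd (k, 0) * Ft (x, t))) (at x)"
    using assms(2) by fastforce
  then show ?thesis
    unfolding has_field_derivative_def
    by (rule has_derivative_eq_rhs) (auto simp: algebra_simps)
qed

text \<open>Translates the iterated \<open>partial_t\<close> and \<open>partial_x\<close> into
  components of total derivatives; \<open>T > 0\<close> makes the one-sided time derivatives unique.
  Symmetry of mixed partials is obtained where a full neighbourhood lies in the strip, that is for 0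
  < t < T.\<close>

lemma classical_solution_partials:
  assumes sol: "classical_solution p q A B \<epsilon> f g T u" and "T > 0"
  obtains ux ut uxx uxt utx utt where
    "\<And>z. z \<in> UNIV \<times> {0..T} \<Longrightarrow>
      ((\<lambda>z. u (fst z) (snd z)) has_derivative (\<lambda>h. fst h * ux z + snd h * ut z)) (at z within UNIV \<times> {0..T})"
    "\<And>z. z \<in> UNIV \<times> {0..T} \<Longrightarrow>
      (ux has_derivative (\<lambda>h. fst h * uxx z + snd h * uxt z)) (at z within UNIV \<times> {0..T})"
    "\<And>z. z \<in> UNIV \<times> {0..T} \<Longrightarrow>
      (ut has_derivative (\<lambda>h. fst h * utx z + snd h * utt z)) (at z within UNIV \<times> {0..T})"
    "\<And>x t. t \<in> {0<..<T} \<Longrightarrow> uxt (x, t) = utx (x, t)"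
    "\<And>x t. t \<in> {0<..<T} \<Longrightarrow> utt (x, t) - uxx (x, t) = A * \<bar>ut (x, t)\<bar> powr p + B * \<bar>u x t\<bar> powr q"
    "\<And>x. ut (x, 0) = \<epsilon> * g x"
proof -
  let ?S = "UNIV \<times> {0..T} :: (real \<times> real) set"
  let ?u = "\<lambda>z. u (fst z) (snd z)"
  have "Ck_on (Suc (Suc 0)) ?S ?u"
    using sol by (simp add: classical_solution_def case_prod_beta' numeral_2_eq_2)
  then obtain ux ut where "Ck_on (Suc 0) ?S ux" "Ck_on (Suc 0) ?S ut"
    and du: "\<And>z. z \<in> ?S \<Longrightarrow> (?u has_derivative (\<lambda>h. fst h * ux z + snd h * ut z)) (at z within ?S)"
    by (rule Ck_on_Suc_obtain_partials) blast
  obtain uxx uxt where cxt: "Ck_on 0 ?S uxt"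
    and dux: "\<And>z. z \<in> ?S \<Longrightarrow> (ux has_derivative (\<lambda>h. fst h * uxx z + snd h * uxt z)) (at z within ?S)"
    using \<open>Ck_on (Suc 0) ?S ux\<close> by (rule Ck_on_Suc_obtain_partials) blast
  obtain utx utt where ctx: "Ck_on 0 ?S utx"
    and dut: "\<And>z. z \<in> ?S \<Longrightarrow> (ut has_derivative (\<lambda>h. fst h * utx z + snd h * utt z)) (at z within ?S)"
    using \<open>Ck_on (Suc 0) ?S ut\<close> by (rule Ck_on_Suc_obtain_partials) blast
  have op: "open (UNIV \<times> {0<..<T} :: (real \<times> real) set)" by (intro open_Times) auto
  have at_eq: "at z within ?S = at z" if "z \<in> UNIV \<times> {0<..<T}" for z :: "real \<times> real"
    by (rule at_within_interior, rule interiorI[OF op that]) auto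
  have at_eq': "at t within {0..T} = at t" if "t \<in> {0<..<T}" for t :: real
    using that by (simp add: at_within_Icc_at)
  have mixed: "uxt (a, b) = utx (a, b)" if b: "b \<in> {0<..<T}" for a b
  proof (rule mixed_partials_eq[where u = u and r = "min b (T - b)"
        and ux = "\<lambda>x t. ux (x, t)" and ut = "\<lambda>x t. ut (x, t)"
        and uxt = "\<lambda>x t. uxt (x, t)" and utx = "\<lambda>x t. utx (x, t)"])
    have in_S: "(a, b) \<in> ?S" using b by auto
    have at_ab: "at (a, b) within ?S = at (a, b)" by (rule at_eq) (use b in auto)
    show "isCont (\<lambda>z. uxt (fst z, snd z)) (a, b)"
      using cxt in_S at_ab unfolding Ck_on.simps continuous_on_eq_continuous_within prod.collapse
      by metis
    show "isCont (\<lambda>z. utx (fst z, snd z)) (a, b)"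
      using ctx in_S at_ab unfolding Ck_on.simps continuous_on_eq_continuous_within prod.collapse
      by metis
  next
    fix x t :: real
    assume "\<bar>t - b\<bar> < min b (T - b)"
    then have t: "t \<in> {0<..<T}" "t \<in> {0..T}" by auto
    show "((\<lambda>y. u y t) has_real_derivative ux (x, t)) (at x)"
      using strip_derivative_horizontal[OF du t(2), of x] by simp
    show "((\<lambda>y. ut (y, t)) has_real_derivative utx (x, t)) (at x)"
      using strip_derivative_horizontal[OF dut t(2), of x] by simp
    show "((\<lambda>s. u x s) has_real_derivative ut (x, t)) (at t)"
      using strip_derivative_along_line[OF du t(2), of x 0] at_eq'[OF t(1)] by simp
    show "((\<lambda>s. ux (x, s)) has_real_derivative uxt (x, t)) (at t)"
      using strip_derivative_along_line[OF dux t(2), of x 0] at_eq'[OF t(1)] by simp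
  qed (use b in auto)
  have pt: "partial_t T u x t = ut (x, t)" if "t \<in> {0..T}" for x t
    unfolding partial_t_def
    using strip_derivative_along_line[OF du that, of x 0] \<open>T > 0\<close> that
    by (intro vector_derivative_within_closed_interval)
      (auto simp: has_real_derivative_iff_has_vector_derivative)
  have ptt: "partial_t T (partial_t T u) x t = utt (x, t)" if "t \<in> {0..T}" for x t
  proof -
    have "((\<lambda>s. ut (x, s)) has_vector_derivative utt (x, t)) (at t within {0..T})"
      using strip_derivative_along_line[OF dut that, of x 0]
      by (simp add: has_real_derivative_iff_has_vector_derivative)
    \<comment> \<open>\<open>partial_t T u\<close> agrees with \<open>ut\<close> on all of
      \<open>{0..T}\<close>, so the outer derivative within that interval is the same.\<close>
    then have "((\<lambda>s. partial_t T u x s) has_vector_derivative utt (x, t)) (at t within {0..T})"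
      by (rule has_vector_derivative_transform[OF that, rotated]) (rule pt)
    then show ?thesis
      unfolding partial_t_def[of T "partial_t T u"]
      using \<open>T > 0\<close> that by (intro vector_derivative_within_closed_interval)
  qed
  have px: "partial_x u x t = ux (x, t)" if "t \<in> {0..T}" for x t
    unfolding partial_x_def
    using strip_derivative_horizontal[OF du that, of x] by (auto intro!: DERIV_imp_deriv)
  have pxx: "partial_x (partial_x u) x t = uxx (x, t)" if "t \<in> {0..T}" for x t
    unfolding partial_x_def[of "partial_x u"] px[OF that]
    using strip_derivative_horizontal[OF dux that, of x] by (auto intro!: DERIV_imp_deriv)
  show thesis
  proof (rule that[OF du dux dut mixed])
    show "utt (x, t) - uxx (x, t) = A * \<bar>ut (x, t)\<bar> powr p + B * \<bar>u x t\<bar> powr q"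
      if "t \<in> {0<..<T}" for x t
    proof -
      have t: "t \<in> {0..T}" using that by auto
      then show ?thesis
        using sol unfolding classical_solution_def by (metis pt ptt pxx)
    qed
    show "ut (x, 0) = \<epsilon> * g x" for x
      using sol pt[of 0 x] \<open>T > 0\<close> unfolding classical_solution_def by simp
  qed
qed

subsection \<open>Riemann invariants\<close>

text \<open>Subtracting \<open>m * s\<close> reduces the claim to monotonicity, which asks for
  derivatives inside the interval and continuity at its ends.\<close>

lemma DERIV_ge_imp_growth:
  fixes h :: "real \<Rightarrow> real"
  assumes "a \<le> b" and "continuous_on {a..b} h"
    and "\<And>s. a < s \<Longrightarrow> s < b \<Longrightarrow> \<exists>y\<ge>m. (h has_real_derivative y) (at s)"
  shows "h a + m * (b - a) \<le> h b"
proof -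
  have "h a - m * a \<le> h b - m * b"
  proof (rule DERIV_nonneg_imp_increasing_open[OF \<open>a \<le> b\<close>])
    show "continuous_on {a..b} (\<lambda>s. h s - m * s)"
      using assms(2) by (intro continuous_intros)
    fix s assume "a < s" "s < b"
    then obtain y where "y \<ge> m" "(h has_real_derivative y) (at s)"
      using assms(3) by blast
    then show "\<exists>y. ((\<lambda>s. h s - m * s) has_real_derivative y) (at s) \<and> 0 \<le> y"
      by (intro exI[of _ "y - m"]) (auto intro!: derivative_eq_intros)
  qed
  then show ?thesis by (simp add: algebra_simps)
qed

text \<open>Interface between the regularity of the solution and the estimates: only derivatives
  along characteristics remain. With z = u_t - u_x and w = u_t + u_x, \<open>(w + z) / 2\<close> is
  u_t, and u has derivative \<open>z\<close> along incoming lines. The initial values of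
  \<open>z\<close> and \<open>w\<close> express u_t = 0 at t = 0.\<close>

locale riemann_invariants =
  fixes A B p q \<epsilon> T :: real and f f' :: "real \<Rightarrow> real" and u z w :: "real \<Rightarrow> real \<Rightarrow> real"
  assumes A_pos: "A > 0" and B_pos: "B > 0" and eps_pos: "\<epsilon> > 0"
    and p_gt_1: "p > 1" and q_gt_1: "q > 1"
    and f_nonneg: "\<And>x. f x \<ge> 0"
    and f_deriv: "\<And>x. (f has_real_derivative f' x) (at x)"
    and u_deriv: "\<And>\<eta> s. s \<in> {0..T} \<Longrightarrow>
      ((\<lambda>s. u (\<eta> - s) s) has_real_derivative z (\<eta> - s) s) (at s within {0..T})"
    and z_cont: "\<And>\<xi>. continuous_on {0..T} (\<lambda>s. z (\<xi> + s) s)"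
    and w_cont: "\<And>\<eta>. continuous_on {0..T} (\<lambda>s. w (\<eta> - s) s)"
    and z_deriv: "\<And>\<xi> s. s \<in> {0<..<T} \<Longrightarrow> ((\<lambda>s. z (\<xi> + s) s) has_real_derivative
      A * \<bar>(w (\<xi> + s) s + z (\<xi> + s) s) / 2\<bar> powr p + B * \<bar>u (\<xi> + s) s\<bar> powr q) (at s)"
    and w_deriv: "\<And>\<eta> s. s \<in> {0<..<T} \<Longrightarrow> ((\<lambda>s. w (\<eta> - s) s) has_real_derivative
      A * \<bar>(w (\<eta> - s) s + z (\<eta> - s) s) / 2\<bar> powr p + B * \<bar>u (\<eta> - s) s\<bar> powr q) (at s)"
    and u_init: "\<And>x. u x 0 = \<epsilon> * f x"
    and z_init: "\<And>x. z x 0 = - \<epsilon> * f' x"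
    and w_init: "\<And>x. w x 0 = \<epsilon> * f' x"
begin

definition F :: "real \<Rightarrow> real \<Rightarrow> real" where
  "F x t = A * \<bar>(w x t + z x t) / 2\<bar> powr p + B * \<bar>u x t\<bar> powr q"

lemma F_nonneg: "F x t \<ge> 0"
  using A_pos B_pos by (simp add: F_def)

lemma z_growth:
  assumes "0 \<le> s" "s \<le> t" "t \<le> T" and "\<And>r. s < r \<Longrightarrow> r < t \<Longrightarrow> F (\<xi> + r) r \<ge> m"
  shows "z (\<xi> + s) s + m * (t - s) \<le> z (\<xi> + t) t"
proof (rule DERIV_ge_imp_growth[of s t "\<lambda>s. z (\<xi> + s) s" m])
  show "continuous_on {s..t} (\<lambda>s. z (\<xi> + s) s)"
    using z_cont by (rule continuous_on_subset) (use assms in auto)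
  fix r assume r: "s < r" "r < t"
  show "\<exists>y\<ge>m. ((\<lambda>s. z (\<xi> + s) s) has_real_derivative y) (at r)"
    using z_deriv[of r \<xi>] assms r by (fold F_def) (intro exI[of _ "F (\<xi> + r) r"], auto)
qed (fact assms)

text \<open>As \<open>F\<close> is nonnegative, \<open>z\<close> never falls below its initial value
  at the foot of the outgoing characteristic.\<close>

lemma z_ge:
  assumes "0 \<le> t" "t \<le> T"
  shows "z x t \<ge> - \<epsilon> * f' (x - t)"
  using z_growth[of 0 t 0 "x - t"] assms F_nonneg z_init[of "x - t"] by auto

lemma w_ge:
  assumes "0 \<le> t" "t \<le> T"
  shows "w x t \<ge> \<epsilon> * f' (x + t)"
proof -
  have "w (x + t - 0) 0 + 0 * (t - 0) \<le> w (x + t - t) t"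
  proof (rule DERIV_ge_imp_growth[of 0 t "\<lambda>s. w (x + t - s) s" 0])
    show "continuous_on {0..t} (\<lambda>s. w (x + t - s) s)"
      using w_cont by (rule continuous_on_subset) (use assms in auto)
    fix r assume r: "0 < r" "r < t"
    show "\<exists>y\<ge>0. ((\<lambda>s. w (x + t - s) s) has_real_derivative y) (at r)"
      using w_deriv[of r "x + t"] assms r F_nonneg
      by (fold F_def) (intro exI[of _ "F (x + t - r) r"], auto)
  qed (fact assms)
  then show ?thesis using w_init[of "x + t"] by simp
qed

text \<open>Subtracting the outgoing free wave leaves a function whose derivative along the incoming
  characteristic is nonnegative.\<close>

lemma u_growth:
  assumes "0 \<le> s" "s \<le> t" "t \<le> T"
    and "\<And>r. s < r \<Longrightarrow> r < t \<Longrightarrow> z (\<eta> - r) r \<ge> - \<epsilon> * f' (\<eta> - 2 * r) + m"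
  shows "u (\<eta> - s) s - \<epsilon> / 2 * f (\<eta> - 2 * s) + m * (t - s) \<le> u (\<eta> - t) t - \<epsilon> / 2 * f (\<eta> - 2 * t)"
proof (rule DERIV_ge_imp_growth[of s t "\<lambda>s. u (\<eta> - s) s - \<epsilon> / 2 * f (\<eta> - 2 * s)" m])
  have "continuous_on {0..T} (\<lambda>s. u (\<eta> - s) s)"
    by (rule DERIV_continuous_on[where D = "\<lambda>s. z (\<eta> - s) s"]) (rule u_deriv)
  then have "continuous_on {s..t} (\<lambda>s. u (\<eta> - s) s)"
    by (rule continuous_on_subset) (use assms in auto)
  moreover have "continuous_on UNIV f"
    using f_deriv by (rule DERIV_continuous_on)
  then have "continuous_on {s..t} (\<lambda>s. f (\<eta> - 2 * s))"
    by (rule continuous_on_compose2) (auto intro!: continuous_intros)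
  ultimately show "continuous_on {s..t} (\<lambda>s. u (\<eta> - s) s - \<epsilon> / 2 * f (\<eta> - 2 * s))"
    by (intro continuous_on_diff continuous_on_mult_left)
  fix r assume r: "s < r" "r < t"
  have "((\<lambda>s. u (\<eta> - s) s) has_real_derivative z (\<eta> - r) r) (at r)"
    using u_deriv[of r \<eta>] r assms by (simp add: at_within_Icc_at)
  moreover have "((\<lambda>s. f (\<eta> - 2 * s)) has_real_derivative f' (\<eta> - 2 * r) * (- 2)) (at r)"
    by (rule DERIV_chain2[OF f_deriv]) (auto intro!: derivative_eq_intros)
  ultimately have "((\<lambda>s. u (\<eta> - s) s - \<epsilon> / 2 * f (\<eta> - 2 * s)) has_real_derivative
      z (\<eta> - r) r + \<epsilon> * f' (\<eta> - 2 * r)) (at r)"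
    by (auto intro!: derivative_eq_intros)
  then show "\<exists>y\<ge>m. ((\<lambda>s. u (\<eta> - s) s - \<epsilon> / 2 * f (\<eta> - 2 * s)) has_real_derivative y) (at r)"
    using assms(4)[OF r] by (intro exI[of _ "z (\<eta> - r) r + \<epsilon> * f' (\<eta> - 2 * r)"]) auto
qed (fact assms)

text \<open>By comparison with the free wave, u is at least \<epsilon> / 2 times f(x - t) + f(x +
  t); the second, nonnegative summand is dropped.\<close>

lemma u_ge:
  assumes "0 \<le> t" "t \<le> T"
  shows "u x t \<ge> \<epsilon> / 2 * f (x - t)"
proof -
  have "u (x + t - 0) 0 - \<epsilon> / 2 * f (x + t - 2 * 0) + 0 * (t - 0)
      \<le> u (x + t - t) t - \<epsilon> / 2 * f (x + t - 2 * t)"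
  proof (rule u_growth)
    fix r assume "0 < r" "r < t"
    then show "z (x + t - r) r \<ge> - \<epsilon> * f' (x + t - 2 * r) + 0"
      using z_ge[of r "x + t - r"] assms by (simp add: algebra_simps)
  qed (use assms in auto)
  moreover have "\<epsilon> * f (x + t) \<ge> 0"
    using eps_pos f_nonneg[of "x + t"] by simp
  ultimately show ?thesis using u_init[of "x + t"] by (simp add: algebra_simps)
qed

section \<open>Lower bounds for the source and their effect on u\<close>

lemma F_ge_u:
  assumes "0 \<le> t" "t \<le> T" "0 \<le> m" "m \<le> u x t"
  shows "F x t \<ge> B * m powr q"
proof -
  have "B * m powr q \<le> B * \<bar>u x t\<bar> powr q"
    using assms B_pos q_gt_1 by (intro mult_left_mono powr_mono2) auto
  then show ?thesis using A_pos unfolding F_def by (smt (verit) mult_nonneg_nonneg powr_ge_zero)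
qed

text \<open>When f' vanishes at the foot of the incoming characteristic, \<open>w\<close> is
  nonnegative, so u_t is at least \<open>z / 2\<close>.\<close>

lemma F_ge_ut:
  assumes "0 \<le> t" "t \<le> T" "0 \<le> m" "f' (x + t) = 0" "m \<le> z x t"
  shows "F x t \<ge> A * (m / 2) powr p"
proof -
  have "w x t \<ge> 0" using w_ge[OF assms(1,2), of x] assms(4) by simp
  then have "A * (m / 2) powr p \<le> A * \<bar>(w x t + z x t) / 2\<bar> powr p"
    using assms A_pos p_gt_1 by (intro mult_left_mono powr_mono2) auto
  then show ?thesis using B_pos unfolding F_def by (smt (verit) mult_nonneg_nonneg powr_ge_zero)
qed

text \<open>The characteristic coordinates are \<open>\<alpha> = x + t\<close> and \<open>\<beta> = t - x\<close>.\<close>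

lemma u_ge_of_source:
  assumes "\<alpha>\<^sub>0 \<le> \<alpha>" "\<beta>\<^sub>0 \<le> \<beta>\<^sub>1" "\<beta>\<^sub>1 \<le> \<beta>" "0 \<le> \<alpha>\<^sub>0 + \<beta>\<^sub>0" "\<alpha> + \<beta> \<le> 2 * T"
    and F: "\<And>a b. a \<in> {\<alpha>\<^sub>0..\<alpha>} \<Longrightarrow> b \<in> {\<beta>\<^sub>0..\<beta>\<^sub>1} \<Longrightarrow> F ((a - b) / 2) ((a + b) / 2) \<ge> m"
  shows "u ((\<alpha> - \<beta>) / 2) ((\<alpha> + \<beta>) / 2) \<ge> m / 4 * (\<alpha> - \<alpha>\<^sub>0) * (\<beta>\<^sub>1 - \<beta>\<^sub>0)"
proof -
  \<comment> \<open>Times at which the incoming line x + t = \<alpha> meets the values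
    \<open>\<beta>\<^sub>0\<close>, \<open>\<beta>\<^sub>1\<close> and \<beta> of t - x. The source
    acts on the first stretch.\<close>
  define t0 t1 t2 where "t0 = (\<alpha> + \<beta>\<^sub>0) / 2" and "t1 = (\<alpha> + \<beta>\<^sub>1) / 2" and "t2 = (\<alpha> + \<beta>) / 2"
  have t: "0 \<le> t0" "t0 \<le> t1" "t1 \<le> t2" "t2 \<le> T"
    using assms by (auto simp: t0_def t1_def t2_def)
  have "u (\<alpha> - t0) t0 - \<epsilon> / 2 * f (\<alpha> - 2 * t0) + (m * (\<alpha> - \<alpha>\<^sub>0) / 2) * (t1 - t0)
      \<le> u (\<alpha> - t1) t1 - \<epsilon> / 2 * f (\<alpha> - 2 * t1)"
  proof (rule u_growth)
    fix r assume r: "t0 < r" "r < t1"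
    define b where "b = 2 * r - \<alpha>"
    have b: "b \<in> {\<beta>\<^sub>0..\<beta>\<^sub>1}" using r by (auto simp: b_def t0_def t1_def)
    \<comment> \<open>The outgoing line t - x = b enters the rectangle at time \<open>s\<close>;
      from there to \<open>r\<close> the source raises \<open>z\<close> at rate at least
      \<open>m\<close>.\<close>
    define s where "s = (\<alpha>\<^sub>0 + b) / 2"
    have s: "0 \<le> s" "s \<le> r" "r \<le> T"
      using assms b r t unfolding s_def by (auto simp: b_def)
    have "z (- b + s) s + m * (r - s) \<le> z (- b + r) r"
    proof (rule z_growth[OF s])
      fix r' assume r': "s < r'" "r' < r"
      then have "2 * r' - b \<in> {\<alpha>\<^sub>0..\<alpha>}" by (auto simp: s_def b_def)
      from F[OF this b] show "m \<le> F (- b + r') r'" by (simp add: diff_divide_distrib)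
    qed
    moreover have "z (- b + s) s \<ge> - \<epsilon> * f' (- b)"
      using z_ge[of s "- b + s"] s by simp
    moreover have eqs: "\<alpha> - r = - b + r" "\<alpha> - 2 * r = - b" "m * (\<alpha> - \<alpha>\<^sub>0) / 2 = m * (r - s)"
      by (auto simp: b_def s_def field_simps)
    ultimately show "z (\<alpha> - r) r \<ge> - \<epsilon> * f' (\<alpha> - 2 * r) + m * (\<alpha> - \<alpha>\<^sub>0) / 2"
      unfolding eqs by linarith
  qed (use t in auto)
  moreover have "u (\<alpha> - t0) t0 - \<epsilon> / 2 * f (\<alpha> - 2 * t0) \<ge> 0"
    using u_ge[of t0 "\<alpha> - t0"] t by (simp add: algebra_simps)
  \<comment> \<open>Past \<open>\<beta>\<^sub>1\<close> the gain is merely preserved, hence rate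
    0.\<close>
  moreover have "u (\<alpha> - t1) t1 - \<epsilon> / 2 * f (\<alpha> - 2 * t1) + 0 * (t2 - t1)
      \<le> u (\<alpha> - t2) t2 - \<epsilon> / 2 * f (\<alpha> - 2 * t2)"
  proof (rule u_growth)
    fix r assume "t1 < r" "r < t2"
    then show "z (\<alpha> - r) r \<ge> - \<epsilon> * f' (\<alpha> - 2 * r) + 0"
      using z_ge[of r "\<alpha> - r"] t by (simp add: algebra_simps)
  qed (use t in auto)
  moreover have "\<epsilon> / 2 * f (\<alpha> - 2 * t2) \<ge> 0"
    using eps_pos f_nonneg[of "\<alpha> - 2 * t2"] by simp
  ultimately have "(m * (\<alpha> - \<alpha>\<^sub>0) / 2) * (t1 - t0) \<le> u (\<alpha> - t2) t2"
    by linarith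
  moreover have "(\<alpha> - \<beta>) / 2 = \<alpha> - t2" "m / 4 * (\<alpha> - \<alpha>\<^sub>0) * (\<beta>\<^sub>1 - \<beta>\<^sub>0) = (m * (\<alpha> - \<alpha>\<^sub>0) / 2) * (t1 - t0)"
    by (auto simp: t0_def t1_def t2_def field_simps)
  ultimately show ?thesis by (simp only: t2_def)
qed

end

subsection \<open>Blow-up\<close>

text \<open>With \<open>l = 4 powr (1 / (r - 1))\<close> the \<open>k\<close>-th bound is at least \<open>m * l ^ k\<close>: the
  superlinearity absorbs the loss \<open>4 ^ k\<close> caused by shrinking the domain dyadically.\<close>

lemma slicing_blow_up:
  fixes r m c :: real and S :: "nat \<Rightarrow> 'a set" and h :: "'a \<Rightarrow> real"
  assumes "r > 1" "m > 0" and c: "c * m powr (r - 1) \<ge> 4 powr (1 / (r - 1))"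
    and common: "\<And>k. x\<^sub>0 \<in> S k"
    and init: "\<And>x. x \<in> S 0 \<Longrightarrow> m \<le> h x"
    and step: "\<And>k y x. y > 0 \<Longrightarrow> (\<And>x. x \<in> S k \<Longrightarrow> y \<le> h x) \<Longrightarrow> x \<in> S (Suc k) \<Longrightarrow>
      c * y powr r / 4 ^ k \<le> h x"
  shows False
proof -
  define l :: real where "l = 4 powr (1 / (r - 1))"
  have l: "l > 1" using \<open>r > 1\<close> by (simp add: l_def)
  have lr: "l powr (r - 1) = 4" using \<open>r > 1\<close> by (simp add: l_def powr_powr)
  have "m * l ^ k \<le> h x" if "x \<in> S k" for k x
    using that
  proof (induction k arbitrary: x)
    case 0
    then show ?case using init by simp
  next
    case (Suc k)
    have y: "m * l ^ k > 0" using l \<open>m > 0\<close> by simp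
    \<comment> \<open>One factor is split off; the remaining power \<open>r - 1\<close> of
      \<open>l ^ k\<close> is \<open>4 ^ k\<close>, which cancels the loss.\<close>
    have "(m * l ^ k) powr r = (m * l ^ k) * (m * l ^ k) powr (r - 1)"
      using y powr_mult_base[of "m * l ^ k" "r - 1"] by simp
    also have "(m * l ^ k) powr (r - 1) = m powr (r - 1) * (l powr (r - 1)) ^ k"
      using l \<open>m > 0\<close> by (simp add: powr_mult powr_powr powr_power flip: powr_realpow) (simp add: mult.commute)
    finally have "c * (m * l ^ k) powr r / 4 ^ k = (c * m powr (r - 1)) * (m * l ^ k)"
      by (simp add: lr)
    also have "\<dots> \<ge> l * (m * l ^ k)"
      using c y by (intro mult_right_mono) (auto simp: l_def)
    finally have "m * l ^ Suc k \<le> c * (m * l ^ k) powr r / 4 ^ k"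
      by (simp add: mult_ac)
    also have "\<dots> \<le> h x" using step[OF y Suc.IH Suc.prems] by simp
    finally show ?case .
  qed
  then have "m * l ^ k \<le> h x\<^sub>0" for k using common by blast
  moreover obtain k where "h x\<^sub>0 / m < l ^ k" using real_arch_pow[OF l] by blast
  ultimately show False using \<open>m > 0\<close> by (metis linorder_not_less mult.commute pos_divide_less_eq)
qed

section \<open>Arithmetic relating T and \<epsilon>\<close>

text \<open>The exponent is the one for which the powers of \<epsilon> cancel: raising the bound on
  T to the power \<open>q + 1\<close> controls T^2 * T^(q-1) from below by
  \<open>\<epsilon> powr (- (r * (q - 1)))\<close>, the inverse of what
  \<open>(K * \<epsilon> powr r) powr (q - 1)\<close> contributes.\<close>

lemma lifespan_threshold:
  fixes B C K L T q r \<epsilon> :: real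
  assumes "q > 1" "B > 0" "K > 0" "C > 0" "\<epsilon> > 0"
    and C: "C powr (q + 1) * (B / 64 * (K / 4) powr (q - 1)) \<ge> L"
    and T: "T \<ge> C * \<epsilon> powr (- (r * (q - 1) / (q + 1)))"
  shows "B / 64 * T\<^sup>2 * (K * \<epsilon> powr r * T / 4) powr (q - 1) \<ge> L"
proof -
  have pos: "C * \<epsilon> powr (- (r * (q - 1) / (q + 1))) > 0" using assms by simp
  then have "T > 0" using T by linarith
  have "(C * \<epsilon> powr (- (r * (q - 1) / (q + 1)))) powr (q + 1) = C powr (q + 1) * \<epsilon> powr (- (r * (q - 1)))"
    using assms by (simp add: powr_mult powr_powr)
  then have le: "C powr (q + 1) * \<epsilon> powr (- (r * (q - 1))) \<le> T powr (q + 1)"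
    using powr_mono2[of "q + 1", OF _ less_imp_le[OF pos] T] \<open>q > 1\<close> by simp
  have "L \<le> C powr (q + 1) * (B / 64 * (K / 4) powr (q - 1))" by (fact C)
  also have "\<dots> = C powr (q + 1) * (B / 64 * (K / 4) powr (q - 1)) *
      (\<epsilon> powr (- (r * (q - 1))) * \<epsilon> powr (r * (q - 1)))"
    using \<open>\<epsilon> > 0\<close> by (simp flip: powr_add)
  also have "\<dots> = (C powr (q + 1) * \<epsilon> powr (- (r * (q - 1)))) *
      (B / 64 * (K / 4) powr (q - 1) * \<epsilon> powr (r * (q - 1)))"
    by (simp only: mult_ac)
  also have "\<dots> \<le> T powr (q + 1) * (B / 64 * (K / 4) powr (q - 1) * \<epsilon> powr (r * (q - 1)))"
    using le \<open>B > 0\<close> by (intro mult_right_mono) auto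
  also have "T powr (q + 1) = T\<^sup>2 * T powr (q - 1)"
    using \<open>T > 0\<close> powr_add[of T 2 "q - 1"] by (simp add: add.commute)
  also have "T\<^sup>2 * T powr (q - 1) * (B / 64 * (K / 4) powr (q - 1) * \<epsilon> powr (r * (q - 1)))
      = B / 64 * T\<^sup>2 * (K * \<epsilon> powr r * T / 4) powr (q - 1)"
    using assms \<open>T > 0\<close> powr_mult[of "K / 4 * \<epsilon> powr r" T "q - 1"] powr_mult[of "K / 4" "\<epsilon> powr r" "q - 1"]
    by (simp add: powr_powr)
  finally show ?thesis .
qed

text \<open>For \<epsilon> at most 1 a lifespan bound also forces T above the constant itself, which
  later secures that T is large compared with R.\<close>

lemma ge_of_ge_times_powr:
  fixes C T \<epsilon> e :: real
  assumes "0 < \<epsilon>" "\<epsilon> \<le> 1" "e \<ge> 0" "C > 0" "T \<ge> C * \<epsilon> powr (- e)"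
  shows "T \<ge> C"
proof -
  have "1 \<le> \<epsilon> powr (- e)"
    using assms powr_le1[of e \<epsilon>] by (simp add: powr_minus one_le_inverse)
  then show ?thesis
    using assms mult_left_mono[of 1 "\<epsilon> powr (- e)" C] by linarith
qed

section \<open>Contradictions from a single ray and from a strip of rays\<close>

context riemann_invariants
begin

text \<open>On the ray x - t = R / 2 the differential inequality z' \<ge> A (z / 2)^p is iterated
  over time intervals whose left ends increase to T.\<close>

lemma blow_up_along_outgoing_ray:
  assumes vanish: "\<And>x. x > R \<Longrightarrow> f' x = 0" and "R > 0" "T \<ge> 2 * R"
    and c0: "f' (R / 2) \<le> - c0" "c0 > 0"
    and large: "T * A / (4 * 2 powr p) * (\<epsilon> * c0) powr (p - 1) \<ge> 4 powr (1 / (p - 1))"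
  shows False
proof (rule slicing_blow_up[OF p_gt_1 _ large,
      where S = "\<lambda>k. {T * (1 - 1 / 2 ^ Suc k)..T}" and h = "\<lambda>t. z (R / 2 + t) t" and x\<^sub>0 = T])
  have T: "T > 0" using assms by auto
  show "\<epsilon> * c0 > 0" using eps_pos c0 by simp
  show "T \<in> {T * (1 - 1 / 2 ^ Suc k)..T}" for k
    using T by (simp add: mult_le_cancel_left1)
  show "\<epsilon> * c0 \<le> z (R / 2 + t) t" if "t \<in> {T * (1 - 1 / 2 ^ Suc 0)..T}" for t
  proof -
    have "z (R / 2 + t) t \<ge> - \<epsilon> * f' (R / 2)"
      using z_ge[of t "R / 2 + t"] T that by simp
    then show ?thesis
      using mult_left_mono[OF c0(1), of \<epsilon>] eps_pos by simp
  qed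
  show "T * A / (4 * 2 powr p) * y powr p / 4 ^ k \<le> z (R / 2 + t) t"
    if y: "y > 0" and IH: "\<And>t. t \<in> {T * (1 - 1 / 2 ^ Suc k)..T} \<Longrightarrow> y \<le> z (R / 2 + t) t"
      and t: "t \<in> {T * (1 - 1 / 2 ^ Suc (Suc k))..T}" for k y t
  proof -
    define s where "s = T * (1 - 1 / 2 ^ Suc k)"
    \<comment> \<open>Gap between consecutive left ends: T / 2^(k+1) - T / 2^(k+2).\<close>
    have ts: "t - s \<ge> T / 4 / 2 ^ k"
      using t T by (simp add: s_def field_simps)
    have "T / 4 / 2 ^ k > 0" using T by simp
    with ts have "s \<le> t" by linarith
    have "(1::real) \<le> 2 ^ k" by simp
    \<comment> \<open>Since T \<ge> 2 R, this places x + t beyond R on the ray, where f'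
      vanishes.\<close>
    then have s: "T / 2 \<le> s" using T by (simp add: s_def field_simps)
    have ys: "y \<le> z (R / 2 + s) s" using IH \<open>s \<le> t\<close> t by (auto simp: s_def)
    have "z (R / 2 + s) s + (A * (y / 2) powr p) * (t - s) \<le> z (R / 2 + t) t"
    proof (rule z_growth)
      fix r assume r: "s < r" "r < t"
      show "A * (y / 2) powr p \<le> F (R / 2 + r) r"
      proof (rule F_ge_ut)
        show "y \<le> z (R / 2 + r) r" using IH r t by (auto simp: s_def)
        show "f' (R / 2 + r + r) = 0" using vanish r s assms by simp
      qed (use r s t T y in auto)
    qed (use \<open>s \<le> t\<close> s t T in auto)
    moreover have "T * A / (4 * 2 powr p) * y powr p / 4 ^ k \<le> (A * (y / 2) powr p) * (t - s)"
    proof -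
      \<comment> \<open>In one dimension only \<open>2 ^ k\<close> is lost; it is weakened to the
        \<open>4 ^ k\<close> of the general iteration.\<close>
      have "T / 4 / 4 ^ k \<le> T / 4 / 2 ^ k"
        using T by (intro divide_left_mono power_mono) auto
      then have "A * (y / 2) powr p * (T / 4 / 4 ^ k) \<le> A * (y / 2) powr p * (t - s)"
        using ts A_pos by (intro mult_left_mono) auto
      then show ?thesis using y by (simp add: powr_divide field_simps)
    qed
    ultimately show ?thesis
      using ys y by linarith
  qed
qed

text \<open>The source fills the characteristic rectangle from 2 R to \<alpha> and from - R / 2 to -
  R / 4; the width R / 4 and the factor 1 / 4 give R / 16.\<close>

lemma u_linear_growth:
  assumes "R > 0" "m \<ge> 0"
    and strip: "\<And>\<alpha> \<beta>. \<alpha> \<ge> 2 * R \<Longrightarrow> \<alpha> \<le> 2 * T \<Longrightarrow> \<beta> \<in> {- R / 2..- R / 4} \<Longrightarrow>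
      F ((\<alpha> - \<beta>) / 2) ((\<alpha> + \<beta>) / 2) \<ge> m"
    and "2 * R \<le> \<alpha>" "0 \<le> \<beta>" "\<alpha> + \<beta> \<le> 2 * T"
  shows "u ((\<alpha> - \<beta>) / 2) ((\<alpha> + \<beta>) / 2) \<ge> m * R / 16 * (\<alpha> - 2 * R)"
proof -
  have "m / 4 * (\<alpha> - 2 * R) * (- R / 4 - (- R / 2)) \<le> u ((\<alpha> - \<beta>) / 2) ((\<alpha> + \<beta>) / 2)"
    by (rule u_ge_of_source) (use assms in auto)
  then show ?thesis by (simp add: algebra_simps)
qed

text \<open>Squares in characteristic coordinates shrink to the corner \<open>(T, T)\<close>, the
  point x = 0 at time T. On each, a lower bound for u bounds the source, which improves the bound
  for u on the next.\<close>

lemma blow_up_of_linear_growth: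
  assumes "R > 0" "T \<ge> 8 * R" "\<mu> > 0"
    and lin: "\<And>\<alpha> \<beta>. 2 * R \<le> \<alpha> \<Longrightarrow> 0 \<le> \<beta> \<Longrightarrow> \<alpha> + \<beta> \<le> 2 * T \<Longrightarrow>
      u ((\<alpha> - \<beta>) / 2) ((\<alpha> + \<beta>) / 2) \<ge> \<mu> * (\<alpha> - 2 * R)"
    and large: "B / 64 * T\<^sup>2 * (\<mu> * T / 4) powr (q - 1) \<ge> 4 powr (1 / (q - 1))"
  shows False
proof (rule slicing_blow_up[OF q_gt_1 _ large,
      where S = "\<lambda>k. {T * (1 - 1 / 2 ^ Suc k)..T} \<times> {T * (1 - 1 / 2 ^ Suc k)..T}"
        and h = "\<lambda>(\<alpha>, \<beta>). u ((\<alpha> - \<beta>) / 2) ((\<alpha> + \<beta>) / 2)" and x\<^sub>0 = "(T, T)"])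
  have T: "T > 0" using assms by auto
  show "\<mu> * T / 4 > 0" using assms T by simp
  show "(T, T) \<in> {T * (1 - 1 / 2 ^ Suc k)..T} \<times> {T * (1 - 1 / 2 ^ Suc k)..T}" for k
    using T by (simp add: mult_le_cancel_left1)
  show "\<mu> * T / 4 \<le> (case x of (\<alpha>, \<beta>) \<Rightarrow> u ((\<alpha> - \<beta>) / 2) ((\<alpha> + \<beta>) / 2))"
    if x: "x \<in> {T * (1 - 1 / 2 ^ Suc 0)..T} \<times> {T * (1 - 1 / 2 ^ Suc 0)..T}" for x
  proof -
    obtain \<alpha> \<beta> where x_eq: "x = (\<alpha>, \<beta>)" by force
    \<comment> \<open>On the first square \<alpha> \<ge> T / 2, and T \<ge> 8 R gives 2 R \<le> T /
      4.\<close>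
    have "\<mu> * (T / 4) \<le> \<mu> * (\<alpha> - 2 * R)"
      using x assms unfolding x_eq by (intro mult_left_mono) auto
    also have "\<dots> \<le> u ((\<alpha> - \<beta>) / 2) ((\<alpha> + \<beta>) / 2)"
      using x assms unfolding x_eq by (intro lin) auto
    finally show ?thesis by (simp add: x_eq)
  qed
  show "B / 64 * T\<^sup>2 * y powr q / 4 ^ k \<le> (case x of (\<alpha>, \<beta>) \<Rightarrow> u ((\<alpha> - \<beta>) / 2) ((\<alpha> + \<beta>) / 2))"
    if y: "y > 0"
      and IH: "\<And>x. x \<in> {T * (1 - 1 / 2 ^ Suc k)..T} \<times> {T * (1 - 1 / 2 ^ Suc k)..T} \<Longrightarrow>
        y \<le> (case x of (\<alpha>, \<beta>) \<Rightarrow> u ((\<alpha> - \<beta>) / 2) ((\<alpha> + \<beta>) / 2))"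
      and x: "x \<in> {T * (1 - 1 / 2 ^ Suc (Suc k))..T} \<times> {T * (1 - 1 / 2 ^ Suc (Suc k))..T}" for k y x
  proof -
    define s where "s = T * (1 - 1 / 2 ^ Suc k)"
    have "(1::real) \<le> 2 ^ k" by simp
    then have s: "T / 2 \<le> s" using T by (simp add: s_def field_simps)
    define h where "h = T / 4 / 2 ^ k"
    have h: "h > 0" using T by (simp add: h_def)
    have next_eq: "T * (1 - 1 / 2 ^ Suc (Suc k)) = s + h"
      by (simp add: s_def h_def field_simps)
    obtain \<alpha> \<beta> where x_eq: "x = (\<alpha>, \<beta>)" by force
    have ab: "s + h \<le> \<alpha>" "\<alpha> \<le> T" "s + h \<le> \<beta>" "\<beta> \<le> T"
      using x unfolding x_eq next_eq by auto
    have "(4::real) ^ k = 2 ^ k * 2 ^ k" by (simp flip: power_mult_distrib)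
    \<comment> \<open>The 64 is 4 from the source estimate times 16 from the square of the step
      \<open>h\<close>; that square also produces \<open>4 ^ k\<close>.\<close>
    then have "B / 64 * T\<^sup>2 * y powr q / 4 ^ k = B * y powr q / 4 * h * h"
      by (simp add: h_def power2_eq_square field_simps)
    also have "\<dots> \<le> B * y powr q / 4 * (\<alpha> - s) * (\<beta> - s)"
      using ab h B_pos by (intro mult_mono mult_nonneg_nonneg) auto
    also have "\<dots> \<le> u ((\<alpha> - \<beta>) / 2) ((\<alpha> + \<beta>) / 2)"
    proof (rule u_ge_of_source)
      fix a b assume r: "a \<in> {s..\<alpha>}" "b \<in> {s..\<beta>}"
      show "B * y powr q \<le> F ((a - b) / 2) ((a + b) / 2)"
      proof (rule F_ge_u)
        show "y \<le> u ((a - b) / 2) ((a + b) / 2)"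
          using IH[of "(a, b)"] r ab h by (auto simp: s_def)
      qed (use r ab h s T y in auto)
    qed (use ab h s T in auto)
    finally show ?thesis by (simp add: x_eq)
  qed
qed

text \<open>Common form of the two strip arguments: \<open>D = A\<close>, \<open>r = p\<close> for
  the source from u_t, and \<open>D = B\<close>, \<open>r = q\<close> for the source from u.\<close>

lemma blow_up_of_strip_source:
  assumes "R > 0" "\<epsilon> \<le> 1" "D > 0" "c > 0" "r > 0" "C \<ge> 8 * R"
    and strip: "\<And>\<alpha> \<beta>. \<alpha> \<ge> 2 * R \<Longrightarrow> \<alpha> \<le> 2 * T \<Longrightarrow> \<beta> \<in> {- R / 2..- R / 4} \<Longrightarrow>
      F ((\<alpha> - \<beta>) / 2) ((\<alpha> + \<beta>) / 2) \<ge> D * (\<epsilon> * c / 2) powr r"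
    and C: "C powr (q + 1) * (B / 64 * ((D * (c / 2) powr r * R / 16) / 4) powr (q - 1))
      \<ge> 4 powr (1 / (q - 1))"
    and T: "T \<ge> C * \<epsilon> powr (- (r * (q - 1) / (q + 1)))"
  shows False
proof -
  define K where "K = D * (c / 2) powr r * R / 16"
  have K: "K > 0" using assms by (simp add: K_def)
  have "T \<ge> C"
    using ge_of_ge_times_powr[OF eps_pos _ _ _ T] assms q_gt_1 by simp
  then have "T \<ge> 8 * R" using assms by linarith
  have K_eq: "D * (\<epsilon> * c / 2) powr r * R / 16 = K * \<epsilon> powr r"
    using powr_mult[of \<epsilon> "c / 2" r] by (simp add: K_def)
  show False
  proof (rule blow_up_of_linear_growth[OF \<open>R > 0\<close> \<open>T \<ge> 8 * R\<close>])
    show "K * \<epsilon> powr r > 0" using K eps_pos by simp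
    show "B / 64 * T\<^sup>2 * (K * \<epsilon> powr r * T / 4) powr (q - 1) \<ge> 4 powr (1 / (q - 1))"
      by (rule lifespan_threshold[OF q_gt_1 B_pos K _ eps_pos _ T]) (use C assms in \<open>auto simp: K_def\<close>)
    fix \<alpha> \<beta> assume ab: "2 * R \<le> \<alpha>" "0 \<le> \<beta>" "\<alpha> + \<beta> \<le> 2 * T"
    show "K * \<epsilon> powr r * (\<alpha> - 2 * R) \<le> u ((\<alpha> - \<beta>) / 2) ((\<alpha> + \<beta>) / 2)"
      using u_linear_growth[OF \<open>R > 0\<close> _ strip ab] \<open>D > 0\<close> unfolding K_eq by simp
  qed
qed

end

subsection \<open>Classical solutions\<close>

lemma C0k_2_derivative:
  assumes "f \<in> C0k 2"
  shows "(f has_real_derivative deriv f x) (at x)" and "continuous_on UNIV (deriv f)"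
proof -
  obtain D where D: "\<And>z. (f has_derivative D z) (at z)" and C: "Ck_on (Suc 0) UNIV (\<lambda>z. D z 1)"
    using assms by (auto simp: C0k_def numeral_2_eq_2)
  have *: "(f has_real_derivative D x 1) (at x)" for x
  proof -
    interpret bounded_linear "D x" using D by (rule has_derivative_bounded_linear)
    have "D x y = D x 1 * y" for y
      using scaleR[of y 1] by (simp add: mult.commute)
    then have "D x = (*) (D x 1)" by blast
    then show ?thesis using D[of x] by (simp add: has_field_derivative_def)
  qed
  then have d: "deriv f = (\<lambda>x. D x 1)" by (auto intro: DERIV_imp_deriv)
  show "(f has_real_derivative deriv f x) (at x)" using * d by simp
  show "continuous_on UNIV (deriv f)"
    unfolding d using C has_derivative_continuous_on[of UNIV "\<lambda>z. D z 1"] by auto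
qed

lemma deriv_eq_0_outside_supp:
  assumes "supp f \<subseteq> {x. \<bar>x\<bar> \<le> R}" "x > R"
  shows "deriv f x = 0"
proof -
  have "f y = 0" if "y > R" for y
    using assms(1) closure_subset[of "{x. f x \<noteq> 0}"] that by (force simp: supp_def)
  then have "(f has_real_derivative 0) (at x)"
    using assms(2)
    by (intro has_field_derivative_transform_within_open[of "\<lambda>_. 0" 0 x "{R<..}" f] DERIV_const) auto
  then show ?thesis by (rule DERIV_imp_deriv)
qed

text \<open>The interval is compact inside (0, R), so the continuous negative derivative has a
  negative maximum there. Strict decrease and nonnegativity at 3 R / 4 make f positive at R / 2, its
  minimum on the interval.\<close>

lemma profile_bounds:
  fixes f :: "real \<Rightarrow> real"
  assumes "f \<in> C0k 2" "R > 0" "\<And>x. f x \<ge> 0" and neg: "\<And>x. x \<in> {0<..<R} \<Longrightarrow> deriv f x < 0"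
  obtains c where "c > 0" "\<And>x. x \<in> {R/4..R/2} \<Longrightarrow> deriv f x \<le> - c" "\<And>x. x \<in> {R/4..R/2} \<Longrightarrow> f x \<ge> c"
proof -
  have "\<exists>x\<in>{R/4..R/2}. \<forall>y\<in>{R/4..R/2}. deriv f y \<le> deriv f x"
    by (rule continuous_attains_sup)
      (use \<open>R > 0\<close> C0k_2_derivative(2)[OF assms(1)] in \<open>auto elim: continuous_on_subset\<close>)
  then obtain x0 where x0: "x0 \<in> {R/4..R/2}" "\<And>y. y \<in> {R/4..R/2} \<Longrightarrow> deriv f y \<le> deriv f x0"
    by blast
  have dec: "f a > f b" if "0 < a" "a < b" "b < R" for a b
    by (rule DERIV_neg_imp_decreasing[OF that(2)])
      (use that neg C0k_2_derivative(1)[OF assms(1)] in \<open>meson greaterThanLessThan_iff less_le_trans le_less_trans\<close>)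
  have "f (R/2) > 0"
    using dec[of "R/2" "3*R/4"] assms(3)[of "3*R/4"] \<open>R > 0\<close> by simp
  moreover have "f x \<ge> f (R/2)" if "x \<in> {R/4..R/2}" for x
    using dec[of x "R/2"] that \<open>R > 0\<close> by (cases "x = R/2") auto
  moreover have "deriv f x0 < 0" using neg x0(1) \<open>R > 0\<close> by auto
  ultimately show thesis
    using that[of "min (- deriv f x0) (f (R/2))"] x0(2) by fastforce
qed

lemma classical_solution_riemann_invariants:
  assumes sol: "classical_solution p q A B \<epsilon> f g T u" and "T > 0"
    and pos: "A > 0" "B > 0" "\<epsilon> > 0" "p > 1" "q > 1"
    and f: "f \<in> C0k 2" "\<And>x. f x \<ge> 0" and g: "\<And>x. g x = 0"
  obtains z w where "riemann_invariants A B p q \<epsilon> T f (deriv f) u z w"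
proof -
  let ?S = "UNIV \<times> {0..T} :: (real \<times> real) set"
  obtain ux ut uxx uxt utx utt where
    du: "\<And>z. z \<in> ?S \<Longrightarrow> ((\<lambda>z. u (fst z) (snd z)) has_derivative (\<lambda>h. fst h * ux z + snd h * ut z)) (at z within ?S)"
    and dux: "\<And>z. z \<in> ?S \<Longrightarrow> (ux has_derivative (\<lambda>h. fst h * uxx z + snd h * uxt z)) (at z within ?S)"
    and dut: "\<And>z. z \<in> ?S \<Longrightarrow> (ut has_derivative (\<lambda>h. fst h * utx z + snd h * utt z)) (at z within ?S)"
    and mixed: "\<And>x t. t \<in> {0<..<T} \<Longrightarrow> uxt (x, t) = utx (x, t)"
    and eq: "\<And>x t. t \<in> {0<..<T} \<Longrightarrow>
      utt (x, t) - uxx (x, t) = A * \<bar>ut (x, t)\<bar> powr p + B * \<bar>u x t\<bar> powr q"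
    and ut0: "\<And>x. ut (x, 0) = \<epsilon> * g x"
    using sol \<open>T > 0\<close> by (rule classical_solution_partials) blast
  note line = strip_derivative_along_line
  have u0: "u x 0 = \<epsilon> * f x" for x
    using sol by (simp add: classical_solution_def)
  have ux0: "ux (x, 0) = \<epsilon> * deriv f x" for x
  proof (rule DERIV_unique)
    show "((\<lambda>y. u y 0) has_real_derivative ux (x, 0)) (at x)"
      using strip_derivative_horizontal[OF du, of 0 x] \<open>T > 0\<close> by simp
    show "((\<lambda>y. u y 0) has_real_derivative \<epsilon> * deriv f x) (at x)"
      unfolding u0 by (intro DERIV_cmult C0k_2_derivative f)
  qed
  \<comment> \<open>For \<open>(a, b)\<close> equal to (1, -1) or (-1, 1) the mixed derivatives
    cancel by symmetry, leaving u_tt - u_xx, which is the source.\<close>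
  have inv: "((\<lambda>s. ut (c + a * s, s) + b * ux (c + a * s, s)) has_real_derivative
      (a * utx (c + a * s, s) + utt (c + a * s, s)) + b * (a * uxx (c + a * s, s) + uxt (c + a * s, s)))
      (at s within {0..T})" if "s \<in> {0..T}" for a b c s
    by (intro DERIV_add DERIV_cmult line[OF dut that] line[OF dux that])
  have cont: "continuous_on {0..T} (\<lambda>s. ut (c + a * s, s) + b * ux (c + a * s, s))" for a b c
    using inv by (rule DERIV_continuous_on)
  have "riemann_invariants A B p q \<epsilon> T f (deriv f) u
      (\<lambda>x t. ut (x, t) - ux (x, t)) (\<lambda>x t. ut (x, t) + ux (x, t))"
  proof
    fix x \<eta> \<xi> s :: real
    show "continuous_on {0..T} (\<lambda>s. ut (\<xi> + s, s) - ux (\<xi> + s, s))"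
      using cont[of \<xi> 1 "-1"] by simp
    show "continuous_on {0..T} (\<lambda>s. ut (\<eta> - s, s) + ux (\<eta> - s, s))"
      using cont[of \<eta> "-1" 1] by simp
    show "((\<lambda>s. u (\<eta> - s) s) has_real_derivative ut (\<eta> - s, s) - ux (\<eta> - s, s)) (at s within {0..T})"
      if "s \<in> {0..T}"
      using line[OF du that, of \<eta> "-1"] by simp
    assume s: "s \<in> {0<..<T}"
    then have s': "s \<in> {0..T}" and at: "at s within {0..T} = at s"
      by (auto simp: at_within_Icc_at)
    show "((\<lambda>s. ut (\<xi> + s, s) - ux (\<xi> + s, s)) has_real_derivative
        A * \<bar>(ut (\<xi> + s, s) + ux (\<xi> + s, s) + (ut (\<xi> + s, s) - ux (\<xi> + s, s))) / 2\<bar> powr p +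
        B * \<bar>u (\<xi> + s) s\<bar> powr q) (at s)"
      using inv[OF s', of \<xi> 1 "-1"] eq[OF s, of "\<xi> + s"] mixed[OF s, of "\<xi> + s"] at
      by (simp add: algebra_simps)
    show "((\<lambda>s. ut (\<eta> - s, s) + ux (\<eta> - s, s)) has_real_derivative
        A * \<bar>(ut (\<eta> - s, s) + ux (\<eta> - s, s) + (ut (\<eta> - s, s) - ux (\<eta> - s, s))) / 2\<bar> powr p +
        B * \<bar>u (\<eta> - s) s\<bar> powr q) (at s)"
      using inv[OF s', of \<eta> "-1" 1] eq[OF s, of "\<eta> - s"] mixed[OF s, of "\<eta> - s"] at
      by (simp add: algebra_simps)
  qed (use pos f u0 ut0 ux0 g C0k_2_derivative(1)[OF f(1)] in auto)
  then show thesis by (rule that)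
qed

theorem theorem2p4:
  fixes p q A B R :: real and f g :: "real \<Rightarrow> real"
  assumes "p > 1" and "q > 1" and "A > 0" and "B > 0" and "R \<ge> 1"
    and "f \<in> C0k 2" and "supp f \<subseteq> {x. \<bar>x\<bar> \<le> R}"
    and "\<And>x. f x \<ge> 0" and "\<exists>x. f x \<noteq> 0"
    and "\<And>x. x \<in> {0<..<R} \<Longrightarrow> deriv f x < 0"
    and "\<And>x. g x = 0"
  shows "\<exists>\<epsilon>\<^sub>4>0. \<exists>C>0. \<forall>\<epsilon>. 0 < \<epsilon> \<and> \<epsilon> \<le> \<epsilon>\<^sub>4 \<longrightarrow>
    (\<forall>T. (p \<le> (q + 1) / 2 \<and> T \<ge> C * \<epsilon> powr (- (p - 1)) \<or>
          (q + 1) / 2 \<le> p \<and> p \<le> q \<and> T \<ge> C * \<epsilon> powr (- (p * (q - 1) / (q + 1))) \<or>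
          p \<ge> q \<and> T \<ge> C * \<epsilon> powr (- (q * (q - 1) / (q + 1))))
      \<longrightarrow> \<not> (\<exists>u. classical_solution p q A B \<epsilon> f g T u))"
proof -
  have R: "R > 0" using assms by simp
  obtain c where c: "c > 0" "\<And>x. x \<in> {R/4..R/2} \<Longrightarrow> deriv f x \<le> - c" "\<And>x. x \<in> {R/4..R/2} \<Longrightarrow> f x \<ge> c"
    using profile_bounds[OF assms(6) R assms(8,10)] by blast
  \<comment> \<open>\<open>M\<close> and \<open>N\<close> are the coefficients of the strip and ray
    iterations with the powers of \<epsilon> and T removed; \<open>L\<close> is the growth threshold
    of the iteration.\<close>
  define M where "M = (\<lambda>D r. B / 64 * ((D * (c / 2) powr r * R / 16) / 4) powr (q - 1))"
  define L where "L = (\<lambda>r. 4 powr (1 / (r - 1)) :: real)"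
  define N where "N = A / (4 * 2 powr p) * c powr (p - 1)"
  \<comment> \<open>One entry makes T \<ge> 8 R, one serves the ray, and two serve the strips with
    sources from u_t and from u.\<close>
  define C where "C = Max {8 * R, L p / N, (L q / M A p) powr (1 / (q + 1)), (L q / M B q) powr (1 / (q + 1))}"
  have C: "C \<ge> 8 * R" "C \<ge> L p / N"
    "C \<ge> (L q / M A p) powr (1 / (q + 1))" "C \<ge> (L q / M B q) powr (1 / (q + 1))"
    by (auto simp: C_def)
  have CM: "C powr (q + 1) * M D r \<ge> L q" if "D > 0" "C \<ge> (L q / M D r) powr (1 / (q + 1))" for D r
  proof -
    have M: "M D r > 0" using that assms R c by (simp add: M_def)
    have "L q / M D r = ((L q / M D r) powr (1 / (q + 1))) powr (q + 1)"
      using M assms by (simp add: powr_powr L_def)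
    also have "\<dots> \<le> C powr (q + 1)"
      using that(2) assms by (intro powr_mono2) auto
    finally show ?thesis using M by (simp add: field_simps)
  qed
  have main: False
    if e: "0 < \<epsilon>" "\<epsilon> \<le> 1" and sol: "classical_solution p q A B \<epsilon> f g T u"
      and T: "T \<ge> C * \<epsilon> powr (- (p - 1)) \<or> T \<ge> C * \<epsilon> powr (- (p * (q - 1) / (q + 1))) \<or>
        T \<ge> C * \<epsilon> powr (- (q * (q - 1) / (q + 1)))" for \<epsilon> T u
  proof -
    have "C > 0" using C(1) R by linarith
    then have "T \<ge> C"
      using T e assms ge_of_ge_times_powr[OF e, of "p - 1" C T]
        ge_of_ge_times_powr[OF e, of "p * (q - 1) / (q + 1)" C T]
        ge_of_ge_times_powr[OF e, of "q * (q - 1) / (q + 1)" C T] by auto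
    then have "T > 0" "T \<ge> 8 * R" using C(1) R by auto
    obtain z w where "riemann_invariants A B p q \<epsilon> T f (deriv f) u z w"
      using classical_solution_riemann_invariants[OF sol \<open>T > 0\<close> assms(3,4) e(1) assms(1,2,6,8,11)] by blast
    then interpret riemann_invariants A B p q \<epsilon> T f "deriv f" u z w .
    have vanish: "deriv f x = 0" if "x > R" for x
      using deriv_eq_0_outside_supp[OF assms(7) that] .
    note strip_source = blow_up_of_strip_source[OF R e(2) _ c(1) _ C(1)]
    from T consider "T \<ge> C * \<epsilon> powr (- (p - 1))" | "T \<ge> C * \<epsilon> powr (- (p * (q - 1) / (q + 1)))"
      | "T \<ge> C * \<epsilon> powr (- (q * (q - 1) / (q + 1)))" by blast
    then show False
    proof cases
      case 1
      have N: "N > 0" using assms c by (simp add: N_def)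
      show False
      proof (rule blow_up_along_outgoing_ray[OF vanish R])
        show "deriv f (R / 2) \<le> - c" using c(2)[of "R/2"] R by simp
        have "L p \<le> C * N" using C(2) N by (simp add: field_simps)
        \<comment> \<open>The powers of \<epsilon> inserted here cancel: one matches the bound on T,
          the other the size of the data.\<close>
        also have "\<dots> = (C * \<epsilon> powr (- (p - 1))) * (N * \<epsilon> powr (p - 1))"
          using e(1) by (simp add: powr_minus flip: powr_add)
        also have "\<dots> \<le> T * (N * \<epsilon> powr (p - 1))"
          using 1 N by (intro mult_right_mono) auto
        also have "\<dots> = T * A / (4 * 2 powr p) * (\<epsilon> * c) powr (p - 1)"
          using e(1) c(1) by (simp add: N_def powr_mult)
        finally show "4 powr (1 / (p - 1)) \<le> T * A / (4 * 2 powr p) * (\<epsilon> * c) powr (p - 1)"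
          by (simp add: L_def)
      qed (use \<open>T \<ge> 8 * R\<close> R c(1) in auto)
    next
      case 2
      show False
      proof (rule strip_source[OF _ _ _ _ 2])
        show "4 powr (1 / (q - 1)) \<le> C powr (q + 1) * (B / 64 * (A * (c / 2) powr p * R / 16 / 4) powr (q - 1))"
          using CM[OF assms(3) C(3)] by (simp add: L_def M_def)
        fix \<alpha> \<beta> assume ab: "2 * R \<le> \<alpha>" "\<alpha> \<le> 2 * T" "\<beta> \<in> {- R / 2..- R / 4}"
        show "A * (\<epsilon> * c / 2) powr p \<le> F ((\<alpha> - \<beta>) / 2) ((\<alpha> + \<beta>) / 2)"
        proof (rule F_ge_ut)
          \<comment> \<open>On the strip x - t = - \<beta> lies between R / 4 and R / 2, where -f'
            is at least \<open>c\<close>.\<close>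
          have "\<epsilon> * c \<le> - \<epsilon> * deriv f (- \<beta>)"
            using c(2)[of "- \<beta>"] ab e(1) mult_left_mono[of "deriv f (- \<beta>)" "- c" \<epsilon>] by simp
          also have "\<dots> \<le> z ((\<alpha> - \<beta>) / 2) ((\<alpha> + \<beta>) / 2)"
            using z_ge[of "(\<alpha> + \<beta>) / 2" "(\<alpha> - \<beta>) / 2"] ab R by (simp add: field_simps)
          finally show "\<epsilon> * c \<le> z ((\<alpha> - \<beta>) / 2) ((\<alpha> + \<beta>) / 2)" .
          show "deriv f ((\<alpha> - \<beta>) / 2 + (\<alpha> + \<beta>) / 2) = 0"
            using ab R by (intro vanish) (simp add: field_simps)
        qed (use ab R e c in auto)
      qed (use assms in auto)
    next
      case 3
      show False
      proof (rule strip_source[OF _ _ _ _ 3])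
        show "4 powr (1 / (q - 1)) \<le> C powr (q + 1) * (B / 64 * (B * (c / 2) powr q * R / 16 / 4) powr (q - 1))"
          using CM[OF assms(4) C(4)] by (simp add: L_def M_def)
        fix \<alpha> \<beta> assume ab: "2 * R \<le> \<alpha>" "\<alpha> \<le> 2 * T" "\<beta> \<in> {- R / 2..- R / 4}"
        show "B * (\<epsilon> * c / 2) powr q \<le> F ((\<alpha> - \<beta>) / 2) ((\<alpha> + \<beta>) / 2)"
        proof (rule F_ge_u)
          have "\<epsilon> * c / 2 \<le> \<epsilon> / 2 * f (- \<beta>)"
            using c(3)[of "- \<beta>"] ab e(1) by simp
          also have "\<dots> \<le> u ((\<alpha> - \<beta>) / 2) ((\<alpha> + \<beta>) / 2)"
            using u_ge[of "(\<alpha> + \<beta>) / 2" "(\<alpha> - \<beta>) / 2"] ab R by (simp add: field_simps)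
          finally show "\<epsilon> * c / 2 \<le> u ((\<alpha> - \<beta>) / 2) ((\<alpha> + \<beta>) / 2)" .
        qed (use ab R e c in auto)
      qed (use assms in auto)
    qed
  qed
  show ?thesis
  \<comment> \<open>The threshold for \<epsilon> is 1: smallness serves only to deduce T \<ge>
    C.\<close>
  proof (rule exI[of _ 1], rule conjI, simp, rule exI[of _ C], rule conjI)
    show "C > 0" using C(1) R by linarith
  qed (use main in blast)
qed

end
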